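(* Let $R$ be a ring. Perspectivity is transitive in $R$ if and only if every special clean element of $R$ is perspective.
   Context: Rings are associative with unity. Two direct summands $A,B$ of a module $M$ are perspective, written $A\sim_p B$, if they have a common complement, i.e., there is a submodule $C$ with $M=A\oplus C=B\oplus C$. Perspectivity is transitive in the ring $R$ if it is transitive in the module $R_R$: for all direct summands $A,B,C$ of $R_R$, $A\sim_p B\sim_p C$ implies $A\sim_p C$. An element $a\in R$ is special clean if $a=e+u$ for some idempotent $e\in R$ and unit $u\in R$ with $aR\cap eR=0$. An element $a\in R$ is (right) perspective if it is von Neumann regular ($a\in aRa$) and every complement in $R_R$ of the right annihilator $r_R(a)=\{x\in R: ax=0\}$ is perspective with $aR$; this notion is known to be left-right symmetric, so one says simply "perspective". *)

theory Defs
  imports Complex_Main "HOL-Library.Set_Algebras"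
begin

text \<open>
  The sort \<open>{ring, monoid_mult}\<close> is that of associative rings with unity. Unlike \<open>ring_1\<close>
  it does not impose \<open>0 \<noteq> 1\<close>, so the zero ring is included.
  The ring is the whole type, and the submodules of the right regular module are its right
  ideals.
\<close>

text \<open>Closure under negation follows from \<open>- x = x * (- 1)\<close>.\<close>

definition right_ideal :: "'a::{ring, monoid_mult} set \<Rightarrow> bool" where
  "right_ideal A \<longleftrightarrow>
     0 \<in> A \<and> (\<forall>x\<in>A. \<forall>y\<in>A. x + y \<in> A) \<and> (\<forall>x\<in>A. \<forall>r. x * r \<in> A)"

text \<open>\<open>A + C\<close> is the elementwise sum of sets.\<close>

definition complementary :: "'a::{ring, monoid_mult} set \<Rightarrow> 'a set \<Rightarrow> bool" where
  "complementary A C \<longleftrightarrow>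
     right_ideal A \<and> right_ideal C \<and> A + C = UNIV \<and> A \<inter> C = {0}"

definition direct_summand :: "'a::{ring, monoid_mult} set \<Rightarrow> bool" where
  "direct_summand A \<longleftrightarrow> (\<exists>C. complementary A C)"

definition perspective :: "'a::{ring, monoid_mult} set \<Rightarrow> 'a set \<Rightarrow> bool"
    (infix \<open>\<sim>\<^sub>p\<close> 50) where
  "A \<sim>\<^sub>p B \<longleftrightarrow> (\<exists>C. complementary A C \<and> complementary B C)"

definition perspectivity_transitive :: "'a::{ring, monoid_mult} itself \<Rightarrow> bool" where
  "perspectivity_transitive _ \<longleftrightarrow>
     (\<forall>A B C :: 'a set. direct_summand A \<longrightarrow> direct_summand B \<longrightarrow> direct_summand C \<longrightarrow>
        A \<sim>\<^sub>p B \<longrightarrow> B \<sim>\<^sub>p C \<longrightarrow> A \<sim>\<^sub>p C)"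

definition principal_right_ideal :: "'a::{ring, monoid_mult} \<Rightarrow> 'a set" where
  "principal_right_ideal a = {a * x | x. True}"

definition right_annihilator :: "'a::{ring, monoid_mult} \<Rightarrow> 'a set" where
  "right_annihilator a = {x. a * x = 0}"

definition idempotent :: "'a::{ring, monoid_mult} \<Rightarrow> bool" where
  "idempotent e \<longleftrightarrow> e * e = e"

text \<open>Units are two-sided; the ring need not be commutative.\<close>

definition ring_unit :: "'a::{ring, monoid_mult} \<Rightarrow> bool" where
  "ring_unit u \<longleftrightarrow> (\<exists>v. u * v = 1 \<and> v * u = 1)"

definition special_clean :: "'a::{ring, monoid_mult} \<Rightarrow> bool" where
  "special_clean a \<longleftrightarrow>
     (\<exists>e u. idempotent e \<and> ring_unit u \<and> a = e + u \<and>
        principal_right_ideal a \<inter> principal_right_ideal e = {0})"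

definition von_neumann_regular :: "'a::{ring, monoid_mult} \<Rightarrow> bool" where
  "von_neumann_regular a \<longleftrightarrow> (\<exists>x. a = a * x * a)"

definition perspective_element :: "'a::{ring, monoid_mult} \<Rightarrow> bool" where
  "perspective_element a \<longleftrightarrow>
     von_neumann_regular a \<and>
     (\<forall>C. complementary (right_annihilator a) C \<longrightarrow> C \<sim>\<^sub>p principal_right_ideal a)"

end

(*
  Complementary right ideals are exactly the pairs pR, r(p) with p idempotent.

  If a = e + u is special clean and v is the inverse of u, then a v a = a, and r(e) is a
  complement of both r(a) and eR, while eR is also a complement of aR. Hence every complement of
  r(a) is perspective with r(e), which is perspective with aR, and transitivity applies.

  Conversely, let P be a common complement of A and B, and Q one of B and C. With r and b the
  projections onto B along P and along Q, and c the projection onto C along Q, the element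
  a = c r has image C and kernel P. It maps B isomorphically onto C, and 1 - b maps P isomorphically
  onto Q, so a - (1 - b) is a unit mapping the decomposition B + P onto C + Q. Thus a is special
  clean; as A is a complement of P = r(a), it is perspective with C = aR.
*)

theory Submission imports Defs begin

lemma complementary_sym: "complementary A C \<Longrightarrow> complementary C A"
  by (auto simp: complementary_def add.commute Int_commute)

lemma complementary_idempotent:
  fixes p :: "'a::{ring, monoid_mult}"
  assumes "p * p = p"
  shows "complementary (principal_right_ideal p) (right_annihilator p)"
proof -
  have "right_ideal (principal_right_ideal p)"
    unfolding right_ideal_def principal_right_ideal_def
    by (auto simp: mult.assoc simp flip: distrib_left intro: exI[of _ 0])
  moreover have "right_ideal (right_annihilator p)"
    unfolding right_ideal_def right_annihilator_def
    by (auto simp: distrib_left simp flip: mult.assoc)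
  moreover have "x \<in> principal_right_ideal p + right_annihilator p" for x
  proof (rule set_plus_intro[of "p * x" _ "x - p * x", simplified])
    show "p * x \<in> principal_right_ideal p"
      by (auto simp: principal_right_ideal_def)
    show "x - p * x \<in> right_annihilator p"
      using assms by (simp add: right_annihilator_def right_diff_distrib flip: mult.assoc)
  qed
  moreover have "principal_right_ideal p \<inter> right_annihilator p = {0}"
    using assms unfolding principal_right_ideal_def right_annihilator_def
    by (auto simp flip: mult.assoc intro: exI[of _ 0])
  ultimately show ?thesis
    by (auto simp: complementary_def)
qed

text \<open>Decomposing \<open>1 = p + q\<close> along \<open>A\<close> and \<open>C\<close> gives
  the projections: left multiplication by \<open>p\<close> is the projection onto \<open>A\<close>
  along \<open>C\<close>.\<close>

lemma complementary_imp_idempotent: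
  fixes A C :: "'a::{ring, monoid_mult} set"
  assumes "complementary A C"
  obtains p where "p * p = p" "A = principal_right_ideal p" "C = right_annihilator p"
proof -
  have rA: "right_ideal A" and rC: "right_ideal C" and int: "A \<inter> C = {0}"
    and "1 \<in> A + C"
    using assms by (auto simp: complementary_def)
  then obtain p q where p: "p \<in> A" and q: "q \<in> C" and pq: "1 = p + q"
    by (auto elim: set_plus_elim)
  have split: "x = p * x + q * x" for x
    by (metis distrib_right mult_1_left pq)
  have pA: "p * x \<in> A" and qC: "q * x \<in> C" for x
    using p q rA rC by (auto simp: right_ideal_def)
  have neg: "- x \<in> D" if "right_ideal D" "x \<in> D" for D and x :: 'a
    using that by (metis right_ideal_def mult_1_right mult_minus_right)
  have diff: "x - y \<in> D" if "right_ideal D" "x \<in> D" "y \<in> D" for D and x y :: 'a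
    using that neg[of D y] by (metis right_ideal_def diff_conv_add_uminus)
  \<comment> \<open>The other component \<open>q * x\<close> is a difference of elements of
    \<open>A\<close> and also lies in \<open>C\<close>, so it vanishes.\<close>
  have fix_A: "p * x = x" if "x \<in> A" for x
  proof -
    have "q * x = x - p * x"
      using split[of x] by (metis add_diff_cancel_left')
    then have "q * x \<in> A \<inter> C"
      using diff[OF rA that pA[of x]] qC[of x] by simp
    then show ?thesis
      using int split[of x] by auto
  qed
  have kill_C: "p * x = 0" if "x \<in> C" for x
  proof -
    have "p * x = x - q * x"
      using split[of x] by (metis add_diff_cancel_right')
    then have "p * x \<in> A \<inter> C"
      using diff[OF rC that qC[of x]] pA[of x] by simp
    then show ?thesis
      using int by auto
  qed
  show thesis
  proof
    show "p * p = p"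
      using fix_A p by blast
    show "A = principal_right_ideal p"
      unfolding principal_right_ideal_def using fix_A[symmetric] pA by blast
    have "x \<in> C" if "p * x = 0" for x
      using split[of x] qC[of x] that by simp
    then show "C = right_annihilator p"
      using kill_C by (auto simp: right_annihilator_def)
  qed
qed

text \<open>An idempotent acts as the identity on its image, which here contains
  \<open>q\<close>.\<close>

lemma idempotent_mult_eq_right:
  fixes p q :: "'a::{ring, monoid_mult}"
  assumes "p * p = p" "principal_right_ideal p = principal_right_ideal q"
  shows "p * q = q"
proof -
  have "q \<in> principal_right_ideal q"
    unfolding principal_right_ideal_def by (metis (mono_tags, lifting) mem_Collect_eq mult_1_right)
  then obtain x where "q = p * x"
    using assms(2) by (auto simp: principal_right_ideal_def)
  then show ?thesis
    using assms(1) by (simp flip: mult.assoc)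
qed

text \<open>The element \<open>1 - q\<close> lies in the common annihilator, so \<open>p\<close>
  kills it.\<close>

lemma idempotent_mult_eq_left:
  fixes p q :: "'a::{ring, monoid_mult}"
  assumes "q * q = q" "right_annihilator p = right_annihilator q"
  shows "p * q = p"
proof -
  have "1 - q \<in> right_annihilator q"
    using assms(1) by (simp add: right_annihilator_def right_diff_distrib)
  then have "p * (1 - q) = 0"
    using assms(2) by (auto simp: right_annihilator_def)
  then show ?thesis
    by (simp add: right_diff_distrib)
qed

text \<open>With \<open>v\<close> the inverse of the unit, \<open>a * v\<close> and
  \<open>v * a\<close> are idempotents. The first has image \<open>aR\<close> and kernel
  \<open>eR\<close>, the second has image \<open>r(e)\<close> and kernel
  \<open>r(a)\<close>.\<close>

lemma special_clean_decomposition: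
  fixes a :: "'a::{ring, monoid_mult}"
  assumes "special_clean a"
  obtains e where "von_neumann_regular a"
    "complementary (principal_right_ideal a) (principal_right_ideal e)"
    "complementary (right_annihilator e) (principal_right_ideal e)"
    "complementary (right_annihilator e) (right_annihilator a)"
proof -
  obtain e u v where ee: "e * e = e" and uv: "u * v = 1" and vu: "v * u = 1" and a: "a = e + u"
    and int: "principal_right_ideal a \<inter> principal_right_ideal e = {0}"
    using assms by (auto simp: special_clean_def idempotent_def ring_unit_def)
  have av: "a * v = e * v + 1" and va: "v * a = v * e + 1"
    by (simp_all add: a uv vu distrib_left distrib_right)
  \<comment> \<open>Both sides equal \<open>e * v * e + e\<close>. The left form lies in
    \<open>eR\<close> and the right form in \<open>aR\<close>, so the trivial intersection forces
    both to be zero.\<close>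
  have "e * (v * a) = a * (v * e)"
    by (simp add: a distrib_left distrib_right flip: mult.assoc) (simp add: uv vu mult.assoc)
  then have "e * (v * a) \<in> principal_right_ideal a \<inter> principal_right_ideal e"
    unfolding principal_right_ideal_def by blast
  then have eva: "e * (v * a) = 0"
    using int by blast
  then have ave: "a * (v * e) = 0"
    using \<open>e * (v * a) = a * (v * e)\<close> by simp
  have ava: "a * v * a = a"
    by (simp add: av distrib_right mult.assoc eva)
  have aR: "principal_right_ideal (a * v) = principal_right_ideal a"
    unfolding principal_right_ideal_def using ava by (metis mult.assoc)
  have eR: "right_annihilator (a * v) = principal_right_ideal e"
  proof -
    have "x = e * - (v * x)" if "a * v * x = 0" for x
      using that by (simp add: av distrib_right mult.assoc add_eq_0_iff)
    moreover have "a * v * (e * y) = 0" for y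
      using ave by (metis mult.assoc mult_zero_left)
    ultimately show ?thesis
      unfolding right_annihilator_def principal_right_ideal_def by blast
  qed
  have re: "principal_right_ideal (v * a) = right_annihilator e"
  proof -
    have "x = v * a * x" if "e * x = 0" for x
      using that by (simp add: va distrib_right mult.assoc)
    moreover have "e * (v * a * y) = 0" for y
      using eva by (metis mult.assoc mult_zero_left)
    ultimately show ?thesis
      unfolding right_annihilator_def principal_right_ideal_def by blast
  qed
  \<comment> \<open>Multiplying by \<open>u\<close> on the left cancels \<open>v\<close>.\<close>
  have ra: "right_annihilator (v * a) = right_annihilator a"
    unfolding right_annihilator_def using uv
    by (metis mult.assoc mult_1_left mult_zero_right)
  show thesis
  proof
    show "von_neumann_regular a"
      using ava by (metis von_neumann_regular_def)
    show "complementary (principal_right_ideal a) (principal_right_ideal e)"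
      using complementary_idempotent[of "a * v"] ava aR eR by (simp flip: mult.assoc)
    show "complementary (right_annihilator e) (principal_right_ideal e)"
      using complementary_idempotent[OF ee] by (rule complementary_sym)
    show "complementary (right_annihilator e) (right_annihilator a)"
      using complementary_idempotent[of "v * a"] ava re ra by (simp add: mult.assoc)
  qed
qed

lemma perspective_perspective_imp_special_clean:
  fixes B C P Q :: "'a::{ring, monoid_mult} set"
  assumes "complementary B P" "complementary B Q" "complementary C Q"
  obtains a where "special_clean a" "right_annihilator a = P" "principal_right_ideal a = C"
proof -
  obtain r where rr: "r * r = r" and r: "B = principal_right_ideal r" "P = right_annihilator r"
    using complementary_imp_idempotent[OF assms(1)] .
  obtain b where bb: "b * b = b" and b: "B = principal_right_ideal b" "Q = right_annihilator b"
    using complementary_imp_idempotent[OF assms(2)] .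
  obtain c where cc: "c * c = c" and c: "C = principal_right_ideal c" "Q = right_annihilator c"
    using complementary_imp_idempotent[OF assms(3)] .
  have br: "b * r = r" and rb: "r * b = b"
    using idempotent_mult_eq_right rr bb r b by metis+
  have bc: "b * c = b" and cb: "c * b = c"
    using idempotent_mult_eq_left bb cc b c by metis+
  \<comment> \<open>The same relations with a trailing factor, so that they still rewrite inside
    products associated to the right.\<close>
  have left: "r * (r * x) = r * x" "b * (b * x) = b * x" "c * (c * x) = c * x"
    "b * (r * x) = r * x" "r * (b * x) = b * x" "b * (c * x) = b * x" "c * (b * x) = c * x" for x
    by (simp_all add: rr bb cc br rb bc cb flip: mult.assoc)
  note rules = rr bb cc br rb bc cb left mult.assoc
  \<comment> \<open>The idempotent of the special clean decomposition is \<open>1 - b\<close>, the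
    projection onto \<open>Q\<close> along \<open>B\<close>.\<close>
  let ?u = "c * r - (1 - b)"
  \<comment> \<open>The inverse is \<open>b\<close> on \<open>C\<close> and \<open>- (1 - r)\<close> on \<open>Q\<close>.\<close>
  let ?v = "b * c - (1 - r) * (1 - c)"
  have "?u * ?v = 1" "?v * ?u = 1"
    by (simp_all add: algebra_simps rules)
  then have unit: "ring_unit ?u"
    unfolding ring_unit_def by blast
  \<comment> \<open>Here \<open>c * r * b = c * b = c\<close>, so \<open>c\<close> is a right
    multiple of \<open>c * r\<close>.\<close>
  have aR: "principal_right_ideal (c * r) = C"
    unfolding c principal_right_ideal_def using rb cb by (metis mult.assoc)
  \<comment> \<open>On \<open>B\<close> the map \<open>c\<close> is undone by \<open>b\<close>,
    since \<open>b * c = b\<close> and \<open>b\<close> fixes \<open>B\<close>.\<close>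
  have "r * x = 0" if "c * (r * x) = 0" for x
    using that left(4,6) by (metis mult_zero_right)
  then have ra: "right_annihilator (c * r) = P"
    unfolding r right_annihilator_def by (auto simp: mult.assoc)
  have "principal_right_ideal (1 - b) \<subseteq> Q"
    unfolding b principal_right_ideal_def right_annihilator_def
    by (auto simp: left_diff_distrib right_diff_distrib left)
  moreover have "C \<inter> Q = {0}"
    using assms(3) by (simp add: complementary_def)
  moreover have "0 \<in> principal_right_ideal x" for x :: 'a
    unfolding principal_right_ideal_def by (auto intro: exI[of _ 0])
  ultimately have "principal_right_ideal (c * r) \<inter> principal_right_ideal (1 - b) = {0}"
    using aR by blast
  moreover have "idempotent (1 - b)"
    by (simp add: idempotent_def left_diff_distrib right_diff_distrib bb)
  moreover have "c * r = (1 - b) + ?u"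
    by simp
  ultimately have "special_clean (c * r)"
    unfolding special_clean_def using unit by blast
  then show thesis
    using that aR ra by blast
qed

theorem theorem4p1:
  "perspectivity_transitive TYPE('a::{ring, monoid_mult}) \<longleftrightarrow>
     (\<forall>a::'a. special_clean a \<longrightarrow> perspective_element a)"
proof
  assume trans: "perspectivity_transitive TYPE('a)"
  show "\<forall>a::'a. special_clean a \<longrightarrow> perspective_element a"
  proof (intro allI impI)
    fix a :: 'a
    assume "special_clean a"
    then obtain e where vnr: "von_neumann_regular a"
      and aR: "complementary (principal_right_ideal a) (principal_right_ideal e)"
      and eR: "complementary (right_annihilator e) (principal_right_ideal e)"
      and ra: "complementary (right_annihilator e) (right_annihilator a)"
      by (rule special_clean_decomposition)
    have "C \<sim>\<^sub>p principal_right_ideal a" if "complementary (right_annihilator a) C" for C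
    proof -
      have C: "complementary C (right_annihilator a)"
        using that by (rule complementary_sym)
      \<comment> \<open>The common complements are \<open>r(a)\<close> for the first pair and
        \<open>eR\<close> for the second.\<close>
      have "C \<sim>\<^sub>p right_annihilator e" "right_annihilator e \<sim>\<^sub>p principal_right_ideal a"
        using C ra eR aR unfolding perspective_def by blast+
      moreover have "direct_summand C" "direct_summand (right_annihilator e)"
        "direct_summand (principal_right_ideal a)"
        using C eR aR unfolding direct_summand_def by blast+
      ultimately show ?thesis
        using trans unfolding perspectivity_transitive_def by blast
    qed
    then show "perspective_element a"
      using vnr by (simp add: perspective_element_def)
  qed
next
  assume special: "\<forall>a::'a. special_clean a \<longrightarrow> perspective_element a"
  have "A \<sim>\<^sub>p C" if "A \<sim>\<^sub>p B" "B \<sim>\<^sub>p C" for A B C :: "'a set"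
  proof -
    obtain P Q where AP: "complementary A P" and "complementary B P"
      and "complementary B Q" "complementary C Q"
      using \<open>A \<sim>\<^sub>p B\<close> \<open>B \<sim>\<^sub>p C\<close> by (auto simp: perspective_def)
    then obtain a where "special_clean a" "right_annihilator a = P" "principal_right_ideal a = C"
      using perspective_perspective_imp_special_clean by metis
    then show ?thesis
      using special complementary_sym[OF AP] unfolding perspective_element_def by blast
  qed
  then show "perspectivity_transitive TYPE('a)"
    unfolding perspectivity_transitive_def by blast
qed

end
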